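(* Let $\omega=e^{\pi i/3}$ and let $\Gamma=\langle A,B\rangle\subset \mathrm{PSL}_2\mathbb{C}$ with $A=\begin{pmatrix}1&1\\0&1\end{pmatrix}$, $B=\begin{pmatrix}1&0\\ \omega&1\end{pmatrix}$. If $X,Y\in\Gamma$ satisfy $\Gamma=\langle X,Y\rangle$ and $\mathrm{tr}\,X=\mathrm{tr}\,Y$, then $X$ and $Y$ are parabolic.
   Context: $\Gamma$ is the image of the discrete faithful representation of the figure-eight knot group $\pi_1(S^3\smallsetminus K)=\langle a,b\mid a^{-1}bab^{-1}a=ba^{-1}bab^{-1}\rangle$ via $a\mapsto A$, $b\mapsto B$; it is a finite-covolume Kleinian subgroup of $\mathrm{PSL}_2(\mathbb{Z}[\omega])$. Traces of elements of $\mathrm{PSL}_2\mathbb{C}$ are taken of lifts to $\mathrm{SL}_2\mathbb{C}$ (so are defined up to sign); "$\mathrm{tr}\,X=\mathrm{tr}\,Y$" means the elements admit lifts of equal trace. An element is parabolic if it is non-identity with $\mathrm{tr}^2=4$. *)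

theory Defs
  imports "HOL-Analysis.Analysis"
begin

type_synonym cmat = "complex^2^2"

definition mat2 :: "complex \<Rightarrow> complex \<Rightarrow> complex \<Rightarrow> complex \<Rightarrow> cmat" where
  "mat2 a b c d = (\<chi> i j. if i = 1 then (if j = 1 then a else b) else (if j = 1 then c else d))"

definition omega :: complex where "omega = exp (complex_of_real pi * \<i> / 3)"

definition matA :: cmat where "matA = mat2 1 1 0 1"
definition matB :: cmat where "matB = mat2 1 0 omega 1"

inductive_set gen_group :: "cmat set \<Rightarrow> cmat set" for S where
  one: "mat 1 \<in> gen_group S"
| base: "x \<in> S \<Longrightarrow> x \<in> gen_group S"
| inv: "x \<in> S \<Longrightarrow> matrix_inv x \<in> gen_group S"
| mult: "x \<in> gen_group S \<Longrightarrow> y \<in> gen_group S \<Longrightarrow> x ** y \<in> gen_group S"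

text \<open>Preimage in SL_2(C) of the subgroup of PSL_2(C) generated by the images of S:
  the subgroup generated by S together with -I.\<close>
definition psl_gen :: "cmat set \<Rightarrow> cmat set" where
  "psl_gen S = gen_group (insert (- mat 1) S)"

definition Gamma_lift :: "cmat set" where "Gamma_lift = psl_gen {matA, matB}"

text \<open>Parabolic element of PSL_2(C) (given by a lift X in SL_2(C)): not \<plusminus>I and trace squared 4.\<close>
definition parabolic :: "cmat \<Rightarrow> bool" where
  "parabolic X \<longleftrightarrow> X \<noteq> mat 1 \<and> X \<noteq> - mat 1 \<and> (trace X)^2 = 4"

end

theory Submission
  imports Defs
begin

text \<open>
  Write \<open>C = XY - YX\<close>. The matrices \<open>X\<close> and \<open>Y\<close> have entries in the Eisenstein integers, and
  \<open>C X = adj(X) C\<close>, \<open>C Y = adj(Y) C\<close>; hence all commutators \<open>PQ - QP\<close> of elements of the group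
  generated by \<open>X\<close> and \<open>Y\<close> lie in the left ideal of integral matrices generated by \<open>C\<close>. Applied
  to \<open>A\<close> and \<open>B\<close>, this shows that \<open>det C\<close> divides the unit \<open>det (AB - BA) = -\<omega>\<^sup>2\<close>.
  For \<open>x = tr X = tr Y\<close> and \<open>z = tr XY\<close> one has \<open>-det C = (z - 2)(z + 2 - x\<^sup>2)\<close>, so both factors
  are units and \<open>x\<^sup>2 - 4\<close> is a difference of two units, of modulus at most 2. As nonzero
  Eisenstein integers have modulus at least 1 and \<open>|x - 2| + |x + 2| \<ge> 4\<close>, this forces \<open>x\<^sup>2 = 4\<close>.
\<close>

section \<open>Eisenstein integers\<close>

definition eisenstein :: "complex set" where
  "eisenstein = {of_int p + of_int q * omega | p q. True}"

lemma omega_eq: "omega = Complex (1 / 2) (sqrt 3 / 2)"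
proof -
  have "omega = cis (pi / 3)"
    unfolding omega_def cis_conv_exp by (simp add: mult.commute)
  then show ?thesis
    by (simp add: cis.ctr cos_60 sin_60)
qed

lemma omega_square: "omega * omega = omega - 1"
  by (simp add: omega_eq complex_eq_iff)

lemma eisensteinI: "of_int p + of_int q * omega \<in> eisenstein"
  unfolding eisenstein_def by blast

lemma eisenstein_0: "0 \<in> eisenstein" and eisenstein_1: "1 \<in> eisenstein"
  and eisenstein_omega: "omega \<in> eisenstein"
  using eisensteinI[of 0 0] eisensteinI[of 1 0] eisensteinI[of 0 1] by simp_all

lemma eisenstein_add:
  assumes "u \<in> eisenstein" "v \<in> eisenstein" shows "u + v \<in> eisenstein"
proof -
  obtain p q r s where "u = of_int p + of_int q * omega" "v = of_int r + of_int s * omega"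
    using assms unfolding eisenstein_def by blast
  then have "u + v = of_int (p + r) + of_int (q + s) * omega"
    by (simp add: algebra_simps)
  then show ?thesis by (metis eisensteinI)
qed

lemma eisenstein_minus:
  assumes "u \<in> eisenstein" shows "- u \<in> eisenstein"
proof -
  obtain p q where "u = of_int p + of_int q * omega"
    using assms unfolding eisenstein_def by blast
  then have "- u = of_int (- p) + of_int (- q) * omega"
    by (simp add: algebra_simps)
  then show ?thesis by (metis eisensteinI)
qed

lemma eisenstein_diff: "u \<in> eisenstein \<Longrightarrow> v \<in> eisenstein \<Longrightarrow> u - v \<in> eisenstein"
  using eisenstein_add[of u "- v"] eisenstein_minus by simp

lemma eisenstein_mult:
  assumes "u \<in> eisenstein" "v \<in> eisenstein" shows "u * v \<in> eisenstein"
proof -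
  obtain p q r s where uv: "u = of_int p + of_int q * omega" "v = of_int r + of_int s * omega"
    using assms unfolding eisenstein_def by blast
  have "u * v = of_int p * of_int r + (of_int p * of_int s + of_int q * of_int r) * omega
      + of_int q * of_int s * (omega * omega)"
    by (simp add: uv algebra_simps)
  also have "\<dots> = of_int (p * r - q * s) + of_int (p * s + q * r + q * s) * omega"
    by (simp add: omega_square algebra_simps)
  finally show ?thesis by (metis eisensteinI)
qed

lemmas eisenstein_intros = eisenstein_0 eisenstein_1 eisenstein_omega eisenstein_add
  eisenstein_minus eisenstein_diff eisenstein_mult

lemma eisenstein_numeral: "numeral n \<in> eisenstein"
  using eisensteinI[of "numeral n" 0] by simp

text \<open>The squared modulus is the norm form \<open>p * p + p * q + q * q\<close>, an integer
  that is positive when \<open>u\<close> is nonzero.\<close>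

lemma eisenstein_norm_ge_1:
  assumes "u \<in> eisenstein" "u \<noteq> 0" shows "1 \<le> cmod u"
proof -
  obtain p q where u: "u = of_int p + of_int q * omega"
    using assms unfolding eisenstein_def by blast
  have "(cmod u)\<^sup>2 = (real_of_int p + real_of_int q / 2)\<^sup>2 + (real_of_int q * (sqrt 3 / 2))\<^sup>2"
    by (simp add: u omega_eq cmod_power2)
  also have "\<dots> = real_of_int (p * p + p * q + q * q)"
    by (simp add: power2_eq_square algebra_simps)
  finally have norm: "(cmod u)\<^sup>2 = real_of_int (p * p + p * q + q * q)" .
  moreover have "0 < (cmod u)\<^sup>2"
    using assms by simp
  ultimately have "1 \<le> p * p + p * q + q * q"
    by linarith
  then have "1\<^sup>2 \<le> (cmod u)\<^sup>2"
    unfolding norm by (simp only: one_power2 of_int_1_le_iff)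
  then show ?thesis
    by (rule power2_le_imp_le) simp
qed

lemma eisenstein_dvd_unit_norm:
  assumes "u \<in> eisenstein" "v \<in> eisenstein" "cmod (u * v) = 1"
  shows "cmod u = 1"
proof -
  have "1 \<le> cmod u" "1 \<le> cmod v"
    using assms by (auto intro!: eisenstein_norm_ge_1)
  moreover have "cmod u * cmod v = 1"
    using assms by (simp add: norm_mult)
  ultimately show ?thesis
    by (metis mult_left_mono mult.right_neutral order_antisym norm_ge_zero)
qed

lemma eisenstein_square_near_4:
  assumes "x \<in> eisenstein" "cmod (x\<^sup>2 - 4) \<le> 2"
  shows "x\<^sup>2 = 4"
proof (rule ccontr)
  assume neq: "x\<^sup>2 \<noteq> 4"
  have factor: "x\<^sup>2 - 4 = (x - 2) * (x + 2)"
    by (simp add: power2_eq_square algebra_simps)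
  have "1 \<le> cmod (x - 2)" "1 \<le> cmod (x + 2)"
    using neq factor assms(1)
    by (auto intro!: eisenstein_norm_ge_1 eisenstein_intros eisenstein_numeral)
  \<comment> \<open>Two reals that are at least 1 have a sum of at most their product plus 1. This
    turns the bound 2 on the product into the bound 3 on the sum.\<close>
  then have "0 \<le> (cmod (x - 2) - 1) * (cmod (x + 2) - 1)"
    by simp
  then have "cmod (x - 2) + cmod (x + 2) \<le> cmod (x - 2) * cmod (x + 2) + 1"
    by (simp add: algebra_simps)
  also have "\<dots> \<le> 3"
    using assms(2) by (simp add: factor norm_mult)
  finally have "cmod (x - 2) + cmod (x + 2) \<le> 3" .
  \<comment> \<open>The points 2 and -2 are at distance 4.\<close>
  moreover have "4 \<le> cmod (x - 2) + cmod (x + 2)"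
    using norm_triangle_ineq4[of "x + 2" "x - 2"] by simp
  ultimately show False by simp
qed

section \<open>Two-by-two matrices\<close>

text \<open>The adjugate, equal to \<open>trace P\<close> times the identity minus \<open>P\<close>.
  It is polynomial in the entries, so it stays integral, and it inverts \<open>P\<close> when
  \<open>det P = 1\<close>.\<close>

definition adj2 :: "cmat \<Rightarrow> cmat" where
  "adj2 P = mat2 (P$2$2) (- P$1$2) (- P$2$1) (P$1$1)"

definition integral_mat :: "cmat set" where
  "integral_mat = {P. \<forall>i j. P$i$j \<in> eisenstein}"

lemma mat2_nth [simp]:
  "mat2 a b c d $ 1 $ 1 = a" "mat2 a b c d $ 1 $ 2 = b"
  "mat2 a b c d $ 2 $ 1 = c" "mat2 a b c d $ 2 $ 2 = d"
  by (simp_all add: mat2_def)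

lemmas cmat_entry_simps = vec_eq_iff forall_2 matrix_matrix_mult_def sum_2 mat_def adj2_def

lemma cmat_mult_minus:
  fixes P Q :: cmat
  shows "(- P) ** Q = - (P ** Q)" "P ** (- Q) = - (P ** Q)"
  by (simp_all add: cmat_entry_simps)

lemma cmat_mult_distrib:
  fixes P Q R :: cmat
  shows "(P + Q) ** R = P ** R + Q ** R"
    "(P - Q) ** R = P ** R - Q ** R" "R ** (P - Q) = R ** P - R ** Q"
  by (simp_all add: cmat_entry_simps algebra_simps)

lemma adj2_minus_one: "adj2 (- mat 1) = - mat 1"
  by (simp add: cmat_entry_simps)

lemma adj2_inverse:
  assumes "det P = 1" shows "P ** adj2 P = mat 1" "adj2 P ** P = mat 1"
  using assms by (simp_all add: cmat_entry_simps det_2 algebra_simps)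

lemma matrix_inv_eq_adj2:
  assumes "det P = 1" shows "matrix_inv P = adj2 P"
proof -
  have "P ** matrix_inv P = mat 1"
    unfolding matrix_inv_def using adj2_inverse[OF assms] by (metis (mono_tags, lifting) someI_ex)
  then show ?thesis
    by (metis adj2_inverse(2)[OF assms] matrix_mul_assoc matrix_mul_lid matrix_mul_rid)
qed

text \<open>\<open>adj2 P\<close> and \<open>- P\<close> differ by a scalar matrix, which commutes
  with \<open>Q\<close>.\<close>

lemma commutator_adj2: "adj2 P ** Q - Q ** adj2 P = - (P ** Q - Q ** P)"
  by (simp add: cmat_entry_simps algebra_simps)

text \<open>By Cayley-Hamilton, XC + CX = [X^2, Y] = tr(X) C for C = [X, Y], and tr(X) - X is the
  adjugate of X; similarly for Y.\<close>

lemma commutator_mult_eq_adj2_mult: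
  fixes X Y :: cmat
  shows "(X ** Y - Y ** X) ** X = adj2 X ** (X ** Y - Y ** X)"
  and "(X ** Y - Y ** X) ** Y = adj2 Y ** (X ** Y - Y ** X)"
  by (simp_all add: cmat_entry_simps algebra_simps)

lemma det_adj2: "det (adj2 P) = det P"
  by (simp add: adj2_def det_2 mult.commute)

text \<open>A form of the Fricke trace identity: for determinants 1 the right-hand side is 2 minus
  the trace of the group commutator of X and Y.\<close>

lemma det_commutator:
  fixes X Y :: cmat
  shows "det (X ** Y - Y ** X) = 4 * det X * det Y - (trace X)\<^sup>2 * det Y - (trace Y)\<^sup>2 * det X
    - (trace (X ** Y))\<^sup>2 + trace X * trace Y * trace (X ** Y)"
  by (simp add: det_2 trace_def sum_2 matrix_matrix_mult_def power2_eq_square algebra_simps)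

lemma integral_mat_intros:
  shows "mat 1 \<in> integral_mat"
  and "P \<in> integral_mat \<Longrightarrow> - P \<in> integral_mat"
  and "P \<in> integral_mat \<Longrightarrow> Q \<in> integral_mat \<Longrightarrow> P - Q \<in> integral_mat"
  and "P \<in> integral_mat \<Longrightarrow> Q \<in> integral_mat \<Longrightarrow> P + Q \<in> integral_mat"
  and "P \<in> integral_mat \<Longrightarrow> Q \<in> integral_mat \<Longrightarrow> P ** Q \<in> integral_mat"
  and "P \<in> integral_mat \<Longrightarrow> adj2 P \<in> integral_mat"
  by (auto simp: integral_mat_def forall_2 mat_def matrix_matrix_mult_def sum_2 adj2_def
      intro!: eisenstein_intros)

lemma trace_integral: "P \<in> integral_mat \<Longrightarrow> trace P \<in> eisenstein"
  and det_integral: "P \<in> integral_mat \<Longrightarrow> det P \<in> eisenstein"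
  by (auto simp: integral_mat_def trace_def sum_2 det_2 intro!: eisenstein_intros)

section \<open>Commutators in a generated group\<close>

definition left_ideal :: "cmat \<Rightarrow> cmat set" where
  "left_ideal C = {P ** C | P. P \<in> integral_mat}"

lemma gen_group_integral:
  assumes "P \<in> gen_group S" "S \<subseteq> integral_mat" "\<And>x. x \<in> S \<Longrightarrow> det x = 1"
  shows "P \<in> integral_mat \<and> det P = 1"
  using assms(1)
proof induction
  case (inv x)
  then show ?case
    using assms(2,3) by (auto simp: matrix_inv_eq_adj2 det_adj2 intro: integral_mat_intros)
qed (use assms(2,3) in \<open>auto simp: det_mul intro: integral_mat_intros\<close>)

lemma left_ideal_add: "P \<in> left_ideal C \<Longrightarrow> Q \<in> left_ideal C \<Longrightarrow> P + Q \<in> left_ideal C"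
  unfolding left_ideal_def
  by clarsimp (metis integral_mat_intros(4) cmat_mult_distrib(1))

lemma left_ideal_mult: "P \<in> integral_mat \<Longrightarrow> Q \<in> left_ideal C \<Longrightarrow> P ** Q \<in> left_ideal C"
  unfolding left_ideal_def
  by clarsimp (metis integral_mat_intros(5) matrix_mul_assoc)

lemma left_ideal_minus: "P \<in> left_ideal C \<Longrightarrow> - P \<in> left_ideal C"
  using left_ideal_mult[of "- mat 1" P C] integral_mat_intros(1,2)
  by (simp add: cmat_mult_minus)

lemma left_ideal_0: "0 \<in> left_ideal C"
  using left_ideal_add[of "mat 1 ** C" C "- (mat 1 ** C)"] left_ideal_minus integral_mat_intros(1)
  unfolding left_ideal_def by force

text \<open>The assumption \<open>twist\<close> moves \<open>C\<close> to the right past a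
  generator, at the price of an integral factor on its left. It will be used with \<open>C\<close>
  the commutator of the two generators.\<close>

locale commutator_ideal =
  fixes S :: "cmat set" and C :: cmat
  assumes integral: "S \<subseteq> integral_mat"
    and det_1: "x \<in> S \<Longrightarrow> det x = 1"
    and twist: "x \<in> S \<Longrightarrow> C ** x = adj2 x ** C"
    and commutators: "x \<in> S \<Longrightarrow> y \<in> S \<Longrightarrow> x ** y - y ** x \<in> left_ideal C"
begin

text \<open>Although \<open>left_ideal C\<close> is only a left ideal, \<open>twist\<close> makes it
  stable under right multiplication by the group.\<close>

lemma gen_group_right_mult:
  assumes "Q \<in> gen_group S" "P \<in> left_ideal C"
  shows "P ** Q \<in> left_ideal C"
  using assms
proof (induction arbitrary: P)
  case one
  then show ?case by simp
next
  case (base x)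
  then obtain R where R: "R \<in> integral_mat" "P = R ** C"
    unfolding left_ideal_def by blast
  then have "P ** x = (R ** adj2 x) ** C"
    by (metis matrix_mul_assoc twist[OF base(1)])
  moreover have "R ** adj2 x \<in> integral_mat"
    using R base integral by (blast intro: integral_mat_intros)
  ultimately show ?case
    unfolding left_ideal_def by blast
next
  case (inv x)
  \<comment> \<open>The twist relation for the inverse: multiply \<open>C ** x = adj2 x ** C\<close>
    by \<open>x\<close> on the left and by \<open>adj2 x\<close> on the right.\<close>
  have "C ** adj2 x = x ** C"
  proof -
    note inverse = adj2_inverse[OF det_1[OF inv(1)]]
    have "C ** adj2 x = (x ** adj2 x) ** C ** adj2 x"
      by (simp only: inverse matrix_mul_lid)
    also have "\<dots> = x ** (adj2 x ** C) ** adj2 x"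
      by (simp only: matrix_mul_assoc)
    also have "\<dots> = x ** C ** (x ** adj2 x)"
      by (simp only: twist[OF inv(1), symmetric] matrix_mul_assoc)
    finally show ?thesis by (simp only: inverse matrix_mul_rid)
  qed
  moreover obtain R where R: "R \<in> integral_mat" "P = R ** C"
    using inv unfolding left_ideal_def by blast
  ultimately have "P ** matrix_inv x = (R ** x) ** C"
    by (metis matrix_mul_assoc matrix_inv_eq_adj2[OF det_1[OF inv(1)]])
  moreover have "R ** x \<in> integral_mat"
    using R inv integral by (blast intro: integral_mat_intros)
  ultimately show ?case
    unfolding left_ideal_def by blast
next
  case (mult x y)
  then show ?case by (simp only: matrix_mul_assoc)
qed

lemma gen_group_commutator_induct:
  assumes "P \<in> gen_group S" and "\<And>x. x \<in> S \<Longrightarrow> x ** Q - Q ** x \<in> left_ideal C"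
  shows "P ** Q - Q ** P \<in> left_ideal C"
  using assms(1)
proof induction
  case one
  then show ?case by (simp add: left_ideal_0)
next
  case (base x)
  then show ?case by (rule assms(2))
next
  case (inv x)
  show ?case
    unfolding matrix_inv_eq_adj2[OF det_1[OF inv]] commutator_adj2
    by (intro left_ideal_minus assms(2) inv)
next
  case (mult x y)
  \<comment> \<open>The Leibniz rule for commutators; its second summand calls for stability under
    right multiplication.\<close>
  have "(x ** y) ** Q - Q ** (x ** y) = x ** (y ** Q - Q ** y) + (x ** Q - Q ** x) ** y"
    by (simp add: cmat_mult_distrib matrix_mul_assoc)
  moreover have "x \<in> integral_mat"
    using gen_group_integral[OF mult(1) integral det_1] by simp
  ultimately show ?case
    using mult by (simp add: left_ideal_add left_ideal_mult gen_group_right_mult)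
qed

text \<open>The induction is applied twice: first to \<open>Q\<close> against a fixed generator,
  then to \<open>P\<close> against the fixed \<open>Q\<close>.\<close>

lemma gen_group_commutator:
  assumes "P \<in> gen_group S" "Q \<in> gen_group S"
  shows "P ** Q - Q ** P \<in> left_ideal C"
proof (rule gen_group_commutator_induct[OF assms(1)])
  fix x assume x: "x \<in> S"
  have "Q ** x - x ** Q \<in> left_ideal C"
    by (rule gen_group_commutator_induct[OF assms(2)]) (rule commutators[OF _ x])
  then show "x ** Q - Q ** x \<in> left_ideal C"
    using left_ideal_minus by fastforce
qed

end

section \<open>The figure-eight knot group\<close>

lemma Gamma_lift_integral:
  assumes "P \<in> Gamma_lift" shows "P \<in> integral_mat \<and> det P = 1"
proof (rule gen_group_integral)
  show "P \<in> gen_group (insert (- mat 1) {matA, matB})"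
    using assms by (simp add: Gamma_lift_def psl_gen_def)
  show "insert (- mat 1) {matA, matB} \<subseteq> integral_mat"
    by (auto simp: integral_mat_def forall_2 mat_def matA_def matB_def intro!: eisenstein_intros)
  show "det x = 1" if "x \<in> insert (- mat 1) {matA, matB}" for x
    using that by (auto simp: det_2 mat_def matA_def matB_def)
qed

lemma norm_det_commutator_matA_matB: "cmod (det (matA ** matB - matB ** matA)) = 1"
proof -
  have "det (matA ** matB - matB ** matA) = - (omega * omega)"
    by (simp add: det_2 matA_def matB_def matrix_matrix_mult_def sum_2)
  moreover have "cmod omega = 1"
    by (simp add: omega_def norm_exp_eq_Re)
  ultimately show ?thesis by (simp add: norm_mult)
qed

text \<open>Since \<open>matA\<close> and \<open>matB\<close> are words in \<open>X\<close>,
  \<open>Y\<close> and \<open>- mat 1\<close>, their commutator is an integral multiple of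
  \<open>C\<close>; now compare determinants.\<close>

lemma norm_det_commutator_generators:
  assumes "X \<in> Gamma_lift" "Y \<in> Gamma_lift" "psl_gen {X, Y} = Gamma_lift"
  shows "cmod (det (X ** Y - Y ** X)) = 1"
proof -
  define C where "C = X ** Y - Y ** X"
  have X: "X \<in> integral_mat" "det X = 1" and Y: "Y \<in> integral_mat" "det Y = 1"
    using assms Gamma_lift_integral by auto
  have C_mem: "C \<in> left_ideal C"
    unfolding left_ideal_def using integral_mat_intros(1) by force
  interpret commutator_ideal "insert (- mat 1) {X, Y}" C
  proof
    show "insert (- mat 1) {X, Y} \<subseteq> integral_mat"
      using X Y by (auto intro: integral_mat_intros)
    show "det x = 1" if "x \<in> insert (- mat 1) {X, Y}" for x
      using that X Y by (auto simp: det_2 mat_def)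
    show "C ** x = adj2 x ** C" if "x \<in> insert (- mat 1) {X, Y}" for x
      using that commutator_mult_eq_adj2_mult[of X Y]
      by (auto simp: C_def adj2_minus_one cmat_mult_minus)
    show "x ** y - y ** x \<in> left_ideal C"
      if "x \<in> insert (- mat 1) {X, Y}" "y \<in> insert (- mat 1) {X, Y}" for x y
      using that C_mem left_ideal_minus[OF C_mem]
      by (auto simp: C_def left_ideal_0 cmat_mult_minus)
  qed
  have "matA \<in> gen_group (insert (- mat 1) {X, Y})" "matB \<in> gen_group (insert (- mat 1) {X, Y})"
    using assms(3) unfolding Gamma_lift_def psl_gen_def by (auto intro: gen_group.base)
  then obtain P where "P \<in> integral_mat" "matA ** matB - matB ** matA = P ** C"
    using gen_group_commutator unfolding left_ideal_def by blast
  moreover have "C \<in> integral_mat"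
    unfolding C_def using X Y by (intro integral_mat_intros)
  ultimately show ?thesis
    using eisenstein_dvd_unit_norm[of "det C" "det P"] norm_det_commutator_matA_matB
    by (simp add: C_def[symmetric] det_mul mult.commute det_integral)
qed

theorem theorem1p2:
  fixes X Y :: cmat
  assumes "X \<in> Gamma_lift" and "Y \<in> Gamma_lift"
    and "psl_gen {X, Y} = Gamma_lift"
    and "trace X = trace Y \<or> trace X = - trace Y"
  shows "parabolic X \<and> parabolic Y"
proof -
  have X: "X \<in> integral_mat" "det X = 1" and Y: "Y \<in> integral_mat" "det Y = 1"
    using assms Gamma_lift_integral by auto
  note unit = norm_det_commutator_generators[OF assms(1-3)]
  define x where "x = trace X"
  obtain s :: complex where s: "s = 1 \<or> s = -1" "trace Y = s * x"
    using assms(4) unfolding x_def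
    by (metis minus_minus mult_1 mult_minus1)
  \<comment> \<open>Replacing \<open>Y\<close> by the lift \<open>s\<close> times \<open>Y\<close>
    makes both traces equal to \<open>x\<close>, and \<open>z\<close> is then the trace of the
    product.\<close>
  define z where "z = s * trace (X ** Y)"
  have x_int: "x \<in> eisenstein" and z_int: "z \<in> eisenstein"
    using s(1) X Y
    by (auto simp: x_def z_def intro!: trace_integral integral_mat_intros eisenstein_intros)
  have u: "z - 2 \<in> eisenstein" and v: "z + 2 - x\<^sup>2 \<in> eisenstein"
    using x_int z_int
    by (auto simp: power2_eq_square intro!: eisenstein_intros eisenstein_numeral)
  have "det (X ** Y - Y ** X) = - ((z - 2) * (z + 2 - x\<^sup>2))"
    using s X Y
    by (auto simp: det_commutator x_def z_def power2_eq_square algebra_simps)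
  then have "cmod ((z - 2) * (z + 2 - x\<^sup>2)) = 1"
    using unit by simp
  then have "cmod (z - 2) = 1" "cmod (z + 2 - x\<^sup>2) = 1"
    using eisenstein_dvd_unit_norm[OF u v] eisenstein_dvd_unit_norm[OF v u]
    by (simp_all add: mult.commute)
  moreover have "x\<^sup>2 - 4 = (z - 2) - (z + 2 - x\<^sup>2)"
    by simp
  ultimately have "cmod (x\<^sup>2 - 4) \<le> 2"
    using norm_triangle_ineq4[of "z - 2" "z + 2 - x\<^sup>2"] by simp
  then have "x\<^sup>2 = 4"
    by (rule eisenstein_square_near_4[OF x_int])
  then have "(trace X)\<^sup>2 = 4" "(trace Y)\<^sup>2 = 4"
    using s by (auto simp: x_def)
  \<comment> \<open>The identity and its negative are central, so a nonzero commutator excludes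
    them.\<close>
  moreover have "X ** Y - Y ** X \<noteq> 0"
    using unit by (auto simp: det_2)
  then have "X \<noteq> mat 1" "X \<noteq> - mat 1" "Y \<noteq> mat 1" "Y \<noteq> - mat 1"
    by (auto simp: cmat_mult_minus)
  ultimately show ?thesis
    by (simp add: parabolic_def)
qed

end
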